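(* Let $X$ be a real normed space and let $K\subset X$ be a convex body. Then for all $\mathbf{x}\in X\setminus K$ we have $$\sigma(K,\mathbf{x})=\frac{\mu(K,\mathbf{x})-1}{\mu(K,\mathbf{x})+1}.$$
   Context: $X$ is a real normed space, $X\neq\{0\}$, with unit sphere $S$. A convex body is a bounded, closed, convex set with nonempty interior. For $\mathbf{x}\in X$ let $\mathcal{L}=\mathcal{L}(K,\mathbf{x})$ be the set of straight lines $l=\{\mathbf{x}+t\mathbf{v}:t\in\mathbb{R}\}$, $\mathbf{v}\in S$, that meet $K$ in more than one point; for $l\in\mathcal{L}$ write $K\cap l=[\mathbf{a},\mathbf{b}]$, $\mathbf{a}\neq\mathbf{b}$, with endpoints labelled so that $\|\mathbf{x}-\mathbf{b}\|\le\|\mathbf{x}-\mathbf{a}\|$. Define $$\sigma(K,\mathbf{x})=\inf_{l\in\mathcal{L}}\frac{\|\mathbf{b}-\mathbf{x}\|}{\|\mathbf{a}-\mathbf{x}\|}\quad(\mathbf{x}\in X),\qquad \mu(K,\mathbf{x})=\inf_{l\in\mathcal{L}}\frac{\|2\mathbf{x}-\mathbf{a}-\mathbf{b}\|}{\|\mathbf{b}-\mathbf{a}\|}\quad(\mathbf{x}\notin K).$$ *)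

theory Defs
  imports "HOL-Analysis.Analysis"
begin

definition convex_body :: "'a::real_normed_vector set \<Rightarrow> bool" where
  "convex_body K \<longleftrightarrow> bounded K \<and> closed K \<and> convex K \<and> interior K \<noteq> {}"

definition line_through :: "'a::real_normed_vector \<Rightarrow> 'a \<Rightarrow> 'a set" where
  "line_through x v = {x + t *\<^sub>R v | t. t \<in> (UNIV :: real set)}"

definition secants :: "'a::real_normed_vector set \<Rightarrow> 'a \<Rightarrow> 'a set set" where
  "secants K x =
    {line_through x v | v. v \<in> sphere 0 1 \<and>
      (\<exists>p \<in> K \<inter> line_through x v. \<exists>q \<in> K \<inter> line_through x v. p \<noteq> q)}"

text \<open>
  The labelling of the endpoints is a relation rather than a function of the line: when
  both endpoints are equally far from \<open>x\<close> the two labellings are both admitted. The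
  quotients in the definitions below do not depend on the choice.
\<close>

definition chord_ends :: "'a::real_normed_vector set \<Rightarrow> 'a \<Rightarrow> 'a set \<Rightarrow> 'a \<Rightarrow> 'a \<Rightarrow> bool" where
  "chord_ends K x l a b \<longleftrightarrow>
    K \<inter> l = closed_segment a b \<and> a \<noteq> b \<and> norm (x - b) \<le> norm (x - a)"

text \<open>
  For a convex body in a nonzero space the sets of quotients are nonempty and bounded below
  by 0, and no denominator vanishes, so the real-valued infima are genuine.
\<close>

definition sigma :: "'a::real_normed_vector set \<Rightarrow> 'a \<Rightarrow> real" where
  "sigma K x =
    Inf {norm (b - x) / norm (a - x) | l a b. l \<in> secants K x \<and> chord_ends K x l a b}"

text \<open>Only meaningful for \<open>x \<notin> K\<close>.\<close>

definition mu :: "'a::real_normed_vector set \<Rightarrow> 'a \<Rightarrow> real" where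
  "mu K x =
    Inf {norm (2 *\<^sub>R x - a - b) / norm (b - a) | l a b.
      l \<in> secants K x \<and> chord_ends K x l a b}"

end

theory Submission imports Defs begin

text \<open>
  Let \<open>x \<notin> K\<close>. On a secant through \<open>x\<close> write the ends of the chord as \<open>a = x + s v\<close> and
  \<open>b = x + t v\<close>. Since \<open>x\<close> is not on the chord, \<open>s\<close> and \<open>t\<close> have the same sign, so with
  \<open>|t| < |s|\<close> the quotient in \<open>mu\<close> is \<open>m = (|s| + |t|) / (|s| - |t|) \<ge> 1\<close>, and the one in
  \<open>sigma\<close> is \<open>|t| / |s| = (m - 1) / (m + 1)\<close> (lemma \<open>chord_quotients\<close>). The map
  \<open>m \<mapsto> (m - 1) / (m + 1)\<close> is increasing and continuous on \<open>[1, \<infinity>)\<close>, hence commutes with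
  infima of nonempty subsets (lemma \<open>Inf_moebius\<close>). That some chord exists comes
  from aiming a line at an interior point of \<open>K\<close> (lemmas \<open>chord_exists\<close> and
  \<open>secant_meets_in_segment\<close>); nonemptiness matters because the infimum of the empty set
  is an unspecified real.
\<close>

text \<open>
  In terms of the distances \<open>T < S\<close> of the two ends from \<open>x\<close>, the midpoint quotient is
  \<open>(S + T) / (S - T)\<close> and the distance quotient is \<open>T / S\<close>. This uses that both ends lie on
  the same side of \<open>x\<close>, which is where \<open>x \<notin> K\<close> enters.
\<close>

lemma chord_quotients:
  assumes "x \<notin> K" "l \<in> secants K x" "chord_ends K x l a b"
  defines "m \<equiv> norm (2 *\<^sub>R x - a - b) / norm (b - a)"
  shows "1 \<le> m" "norm (b - x) / norm (a - x) = (m - 1) / (m + 1)"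
proof -
  obtain v where v: "norm v = 1" and l: "l = line_through x v"
    using assms(2) by (auto simp: secants_def)
  have K: "K \<inter> l = closed_segment a b" and ab: "a \<noteq> b" and le: "norm (x - b) \<le> norm (x - a)"
    using assms(3) by (auto simp: chord_ends_def)
  have "a \<in> l" "b \<in> l"
    using K ends_in_segment by blast+
  then obtain s t where a: "a = x + s *\<^sub>R v" and b: "b = x + t *\<^sub>R v"
    by (auto simp: l line_through_def)
  have "s \<noteq> t" using ab a b by auto
  have ts: "\<bar>t\<bar> \<le> \<bar>s\<bar>" using le v by (simp add: a b)
  have x: "x \<notin> closed_segment a b" using K assms(1) by blast
  have same_sign: "0 < s * t"
  proof (rule ccontr)
    assume "\<not> 0 < s * t"
    then have "0 \<in> closed_segment s t"
      by (auto simp: closed_segment_eq_real_ivl zero_less_mult_iff)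
    then obtain u where u: "0 \<le> u" "u \<le> 1" "0 = (1 - u) * s + u * t"
      by (auto simp: in_segment)
    have "(1 - u) *\<^sub>R a + u *\<^sub>R b = x + ((1 - u) * s + u * t) *\<^sub>R v"
      by (simp add: a b algebra_simps)
    with u have "x = (1 - u) *\<^sub>R a + u *\<^sub>R b"
      by simp
    with u x show False
      by (auto simp: in_segment)
  qed
  have "2 *\<^sub>R x - a - b = - (s + t) *\<^sub>R v" "b - a = (t - s) *\<^sub>R v"
    by (simp_all add: a b scaleR_2 scaleR_add_left scaleR_diff_left)
  then have m: "m = \<bar>s + t\<bar> / \<bar>t - s\<bar>"
    by (simp only: m_def norm_scaleR v abs_minus_cancel mult_1_right)
  define S T where "S = \<bar>s\<bar>" and "T = \<bar>t\<bar>"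
  have q: "norm (b - x) / norm (a - x) = T / S"
    by (simp add: a b v S_def T_def)
  have T: "0 < T" "T < S" and m': "m = (S + T) / (S - T)"
    using same_sign ts \<open>s \<noteq> t\<close> unfolding m S_def T_def by (auto simp: zero_less_mult_iff)
  show "1 \<le> m"
    using T by (simp add: m' field_simps)
  have "m - 1 = 2 * T / (S - T)" "m + 1 = 2 * S / (S - T)"
    using T by (simp_all add: m' field_simps)
  then show "norm (b - x) / norm (a - x) = (m - 1) / (m + 1)"
    using T by (simp add: q)
qed

text \<open>
  The parameters \<open>t\<close> with \<open>x + t v \<in> K\<close> form a compact interval, because \<open>K\<close> is closed,
  bounded and convex; the affine map \<open>t \<mapsto> x + t v\<close> carries it onto the chord.
\<close>

lemma secant_meets_in_segment:
  assumes "bounded K" "closed K" "convex K" "l \<in> secants K x"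
  obtains a b where "chord_ends K x l a b"
proof -
  obtain v p q where v: "norm v = 1" and l: "l = line_through x v"
    and pq: "p \<in> K \<inter> l" "q \<in> K \<inter> l" "p \<noteq> q"
    using assms(4) by (auto simp: secants_def)
  define f where "f t = x + t *\<^sub>R v" for t :: real
  define T where "T = f -` K"
  have l_f: "l = range f"
    by (auto simp: l line_through_def f_def)
  have image: "f ` T = K \<inter> l"
    by (auto simp: T_def l_f)
  have closed: "closed T"
    unfolding T_def f_def by (intro closed_vimage assms continuous_intros)
  have bounded: "bounded T"
  proof -
    obtain e where e: "\<And>y. y \<in> K \<Longrightarrow> dist x y \<le> e"
      using assms(1) bounded_any_center[of K x] by blast
    have "\<bar>t\<bar> \<le> e" if "t \<in> T" for t
      using e[of "f t"] that v by (simp add: T_def f_def dist_norm)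
    then show ?thesis
      by (auto simp: bounded_iff)
  qed
  have segment: "f ` closed_segment c d = closed_segment (f c) (f d)" for c d
  proof -
    have "closed_segment (f c) (f d) = (+) x ` ((\<lambda>t. t *\<^sub>R v) ` closed_segment c d)"
      unfolding f_def closed_segment_translation
      by (subst closed_segment_linear_image[OF linear_scaleR_left]) (rule refl)
    then show ?thesis
      by (simp add: f_def image_image)
  qed
  have "convex T"
    unfolding convex_contains_segment
  proof (intro ballI)
    fix c d assume "c \<in> T" "d \<in> T"
    then have "closed_segment (f c) (f d) \<subseteq> K"
      using closed_segment_subset[OF _ _ assms(3)] by (simp add: T_def)
    then show "closed_segment c d \<subseteq> T"
      unfolding T_def segment[symmetric] by blast
  qed
  then obtain c d where T: "T = {c..d}"
    using connected_compact_interval_1[of T] closed bounded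
    by (auto simp: convex_connected compact_eq_bounded_closed)
  obtain p' q' where "p' \<in> T" "q' \<in> T" "p' \<noteq> q'"
    using pq unfolding image[symmetric] by blast
  then have "c < d"
    using T by auto
  then have "K \<inter> l = closed_segment (f c) (f d)"
    using image segment[of c d] by (simp add: T closed_segment_eq_real_ivl)
  moreover have "f c \<noteq> f d"
    using \<open>c < d\<close> v by (auto simp: f_def)
  ultimately have "chord_ends K x l (f c) (f d) \<or> chord_ends K x l (f d) (f c)"
    by (auto simp: chord_ends_def closed_segment_commute)
  then show ?thesis
    using that by blast
qed

text \<open>
  The line from \<open>x\<close> through the centre \<open>p\<close> of a ball in \<open>K\<close> also passes through a point \<open>q\<close>
  on the boundary of that ball, so it meets \<open>K\<close> more than once.
\<close>

lemma chord_exists: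
  assumes "convex_body K" "x \<notin> K"
  obtains l a b where "l \<in> secants K x" "chord_ends K x l a b"
proof -
  obtain p r where r: "0 < r" and p: "cball p r \<subseteq> K"
    using assms(1) by (auto simp: convex_body_def mem_interior_cball)
  have "p \<in> K"
    using p r by (auto simp: subset_iff)
  then have px: "p \<noteq> x"
    using assms(2) by blast
  define v where "v = (p - x) /\<^sub>R norm (p - x)"
  have v: "norm v = 1"
    using px by (simp add: v_def)
  define q where "q = p + r *\<^sub>R v"
  have "q \<in> K"
    using p r v by (auto simp: q_def subset_iff dist_norm)
  have p_eq: "p = x + norm (p - x) *\<^sub>R v"
    using px by (simp add: v_def)
  then have "q = x + (norm (p - x) + r) *\<^sub>R v"
    unfolding q_def scaleR_add_left by (simp add: add.assoc[symmetric])
  with p_eq have "p \<in> line_through x v" "q \<in> line_through x v"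
    unfolding line_through_def by blast+
  moreover have "p \<noteq> q"
    using r v by (auto simp: q_def)
  ultimately have "line_through x v \<in> secants K x"
    using \<open>p \<in> K\<close> \<open>q \<in> K\<close> v unfolding secants_def mem_sphere_0 by blast
  then show ?thesis
    using secant_meets_in_segment that assms(1) by (metis convex_body_def)
qed

text \<open>
  The function has a pole at \<open>-1\<close>; the lower bound 1 keeps \<open>M\<close> and its infimum on the
  branch where it increases.
\<close>

lemma Inf_moebius:
  fixes M :: "real set"
  assumes "M \<noteq> {}" "\<And>m. m \<in> M \<Longrightarrow> 1 \<le> m"
  shows "Inf ((\<lambda>m. (m - 1) / (m + 1)) ` M) = (Inf M - 1) / (Inf M + 1)"
proof -
  \<comment> \<open>Cutting off at 1 gives an extension that is monotone and continuous on the whole line.\<close>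
  define f where "f m = 1 - 2 / (max m 1 + 1)" for m :: real
  have f: "f m = (m - 1) / (m + 1)" if "1 \<le> m" for m
    using that by (simp add: f_def max_def field_simps)
  have "mono f"
    unfolding f_def by (intro monoI diff_left_mono divide_left_mono) (auto intro!: mult_pos_pos)
  moreover have "continuous (at_right (Inf M)) f"
    unfolding f_def by (intro continuous_intros) auto
  moreover have "bdd_below M"
    using assms(2) by (rule bdd_belowI)
  ultimately have "f (Inf M) = Inf (f ` M)"
    using assms(1) by (intro continuous_at_Inf_mono)
  moreover have "1 \<le> Inf M"
    using assms by (intro cInf_greatest)
  moreover have "f ` M = (\<lambda>m. (m - 1) / (m + 1)) ` M"
    using f assms(2) by (intro image_cong) auto
  ultimately show ?thesis
    using f by simp
qed

theorem proposition4p4: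
  fixes K :: "'a::real_normed_vector set"
  assumes "(UNIV :: 'a set) \<noteq> {0}"
    and "convex_body K"
  shows "\<forall>x \<in> UNIV - K. sigma K x = (mu K x - 1) / (mu K x + 1)"
proof
  fix x assume "x \<in> UNIV - K"
  then have x: "x \<notin> K"
    by simp
  define C where "C = {(a, b). \<exists>l \<in> secants K x. chord_ends K x l a b}"
  define m where "m = (\<lambda>(a, b). norm (2 *\<^sub>R x - a - b) / norm (b - a))"
  define q where "q = (\<lambda>(a, b). norm (b - x) / norm (a - x))"
  have mu: "mu K x = Inf (m ` C)" and sigma: "sigma K x = Inf (q ` C)"
    unfolding mu_def sigma_def C_def m_def q_def by (rule arg_cong[of _ _ Inf], force)+
  obtain l a b where "l \<in> secants K x" "chord_ends K x l a b"
    using chord_exists[OF assms(2) x] .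
  then have "m ` C \<noteq> {}"
    by (auto simp: C_def)
  moreover have "1 \<le> m c" and q_m: "q c = (m c - 1) / (m c + 1)" if "c \<in> C" for c
    using that chord_quotients[OF x] by (auto simp: C_def m_def q_def)
  ultimately have "Inf ((\<lambda>r. (r - 1) / (r + 1)) ` m ` C) = (mu K x - 1) / (mu K x + 1)"
    unfolding mu by (intro Inf_moebius) auto
  then show "sigma K x = (mu K x - 1) / (mu K x + 1)"
    by (simp add: sigma image_image q_m)
qed

end
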